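(* Let $f,g,\phi$ satisfy the composite smoothness assumption, and let the saddle-subdifferential operator $M=(\nabla_u\phi+\partial f,\,-\nabla_v\phi+\partial g)$ of the problem $\min_{u}\max_{v}\{f(u)+\phi(u,v)-g(v)\}$ satisfy the weak MVI condition for some $\rho\in\big[0,\frac{1}{2(L+\hat L)}\big)$. Let $\{x_k\}$ be the sequence of the SA-MGDA method with backtracking line-search for some $\tau_0\in\big[\frac{\delta}{L+\hat L},\infty\big)$ and $\delta\in\big(2\rho(L+\hat L),1\big)$. Let $x_*\in X_*^\rho(M)$ be any point, and assume additionally that $\|x_k-x_*\|\le C$ for all $k$ and for some $C\ge0$. Then, for every $k\ge1$, $$\min_{i=1,\ldots,k}D_{h_i}(x_i,x_{i-1})\le\frac{D_{h_1}(x_*,x_0)+\frac{\tilde L}{2}C^2}{\big(1-\rho\tilde L\big)k},\qquad\text{where }\tilde L:=\frac{2(L+\hat L)}{\delta}.$$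
   Context: Let $d=d_u+d_v$, $x=(u,v)\in\mathbb{R}^{d_u}\times\mathbb{R}^{d_v}=\mathbb{R}^d$ with Euclidean inner product and norm. Composite smoothness assumption: $f:\mathbb{R}^{d_u}\to(-\infty,\infty]$ and $g:\mathbb{R}^{d_v}\to(-\infty,\infty]$ are closed, proper and convex; $\phi:\mathbb{R}^d\to\mathbb{R}$ is continuously differentiable and there are $L_{uu},L_{uv},L_{vu},L_{vv}>0$ with $\|\nabla_u\phi(u,v)-\nabla_u\phi(\bar u,\bar v)\|\le L_{uu}\|u-\bar u\|+L_{uv}\|v-\bar v\|$ and $\|\nabla_v\phi(u,v)-\nabla_v\phi(\bar u,\bar v)\|\le L_{vu}\|u-\bar u\|+L_{vv}\|v-\bar v\|$ for all $u,\bar u,v,\bar v$. $L>0$ denotes a Lipschitz constant of $\nabla\phi$ (equivalently of $(\nabla_u\phi,-\nabla_v\phi)$) on $\mathbb{R}^d$, and $\hat L=\max\{L_{uu},L_{vv}\}$. $\operatorname{gra}M=\{(x,w):w\in Mx\}$; $X_*(M)=\{x_*:0\in Mx_*\}$ (assumed nonempty). Weak MVI condition with $\rho\ge0$: there exists $x_*\in X_*(M)$ such that $\langle x-x_*,w\rangle\ge-\frac\rho2\|w\|^2$ for all $(x,w)\in\operatorname{gra}M$. $X_*^\rho(M)$ is the set of all $x_*\in X_*(M)$ with this property. For a differentiable $h:\mathbb{R}^d\to\mathbb{R}$ put $D_h(x,y)=h(x)-h(y)-\langle\nabla h(y),x-y\rangle$ and $R_M^h=(\nabla h+M)^{-1}\nabla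 h$; "$\bar x=R_M^h(x)$ exists" means that there is a point $\bar x$ with $\nabla h(x)-\nabla h(\bar x)\in M\bar x$. SA-MGDA with backtracking line-search: given $x_0\in\mathbb{R}^d$, $\tau_0$ and $\delta$, for $k=0,1,\dots$: find the smallest nonnegative integer $i_k$ such that, with $\bar\tau=\delta^{i_k}\tau_k$ and $\bar h=\frac{1}{2\bar\tau}\|\cdot\|^2-\phi$, the point $\bar x=R_M^{\bar h}(x_k)$ exists and satisfies $\frac{\bar\tau}{4}\|\nabla\bar h(\bar x)-\nabla\bar h(x_k)\|^2\le D_{\bar h}(\bar x,x_k)$. Then set $\tau_{k+1}=\delta^{i_k}\tau_k$, $h_{k+1}=\frac{1}{2\tau_{k+1}}\|\cdot\|^2-\phi$, and $x_{k+1}=R_M^{h_{k+1}}(x_k)$ (this point $\bar x$). *)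

theory Defs
  imports "HOL-Analysis.Analysis"
begin

definition epi :: "('a \<Rightarrow> ereal) \<Rightarrow> ('a \<times> real) set" where
  "epi f = {(x, r). f x \<le> ereal r}"

definition closed_proper_convex :: "('a::euclidean_space \<Rightarrow> ereal) \<Rightarrow> bool" where
  "closed_proper_convex f \<longleftrightarrow>
     closed (epi f) \<and> convex (epi f) \<and> (\<forall>x. f x \<noteq> -\<infinity>) \<and> (\<exists>x. f x \<noteq> \<infinity>)"

text \<open>For proper functions the set below is empty wherever the function takes the value
  \<^term>\<open>\<infinity> :: ereal\<close>.\<close>

definition subdifferential :: "('a::real_inner \<Rightarrow> ereal) \<Rightarrow> 'a \<Rightarrow> 'a set" where
  "subdifferential f x = {p. \<forall>y. f x + ereal (p \<bullet> (y - x)) \<le> f y}"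

text \<open>The gradient is only meaningful at points of differentiability.\<close>

definition grad :: "('a::real_inner \<Rightarrow> real) \<Rightarrow> 'a \<Rightarrow> 'a" where
  "grad h x = (THE D. GDERIV h x :> D)"

definition grad_u :: "('u::real_inner \<times> 'v::real_inner \<Rightarrow> real) \<Rightarrow> 'u \<Rightarrow> 'v \<Rightarrow> 'u" where
  "grad_u \<phi> u v = grad (\<lambda>u'. \<phi> (u', v)) u"

definition grad_v :: "('u::real_inner \<times> 'v::real_inner \<Rightarrow> real) \<Rightarrow> 'u \<Rightarrow> 'v \<Rightarrow> 'v" where
  "grad_v \<phi> u v = grad (\<lambda>v'. \<phi> (u, v')) v"

definition bregman :: "('a::real_inner \<Rightarrow> real) \<Rightarrow> 'a \<Rightarrow> 'a \<Rightarrow> real" where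
  "bregman h x y = h x - h y - grad h y \<bullet> (x - y)"

text \<open>The (possibly empty or multi-valued) resolvent \<open>R\<^sup>h\<^sub>M = (\<nabla>h + M)\<^sup>-\<^sup>1 \<circ> \<nabla>h\<close> of a set-valued
  operator.\<close>

definition resolvent :: "('a::real_inner \<Rightarrow> 'a set) \<Rightarrow> ('a \<Rightarrow> real) \<Rightarrow> 'a \<Rightarrow> 'a set" where
  "resolvent M h x = {y. grad h x - grad h y \<in> M y}"

definition gra :: "('a \<Rightarrow> 'a set) \<Rightarrow> ('a \<times> 'a) set" where
  "gra M = {(x, w). w \<in> M x}"

definition zeros :: "('a::zero \<Rightarrow> 'a set) \<Rightarrow> 'a set" where
  "zeros M = {x. 0 \<in> M x}"

definition weak_mvi_solutions :: "real \<Rightarrow> ('a::real_inner \<Rightarrow> 'a set) \<Rightarrow> 'a set" where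
  "weak_mvi_solutions \<rho> M =
     {xs \<in> zeros M. \<forall>(x, w) \<in> gra M. (x - xs) \<bullet> w \<ge> - (\<rho> / 2) * (norm w)\<^sup>2}"

definition weak_mvi :: "real \<Rightarrow> ('a::real_inner \<Rightarrow> 'a set) \<Rightarrow> bool" where
  "weak_mvi \<rho> M \<longleftrightarrow> weak_mvi_solutions \<rho> M \<noteq> {}"

definition composite_smooth ::
  "('u::euclidean_space \<Rightarrow> ereal) \<Rightarrow> ('v::euclidean_space \<Rightarrow> ereal) \<Rightarrow> ('u \<times> 'v \<Rightarrow> real) \<Rightarrow>
   real \<Rightarrow> real \<Rightarrow> real \<Rightarrow> real \<Rightarrow> bool" where
  "composite_smooth f g \<phi> Luu Luv Lvu Lvv \<longleftrightarrow>
     closed_proper_convex f \<and> closed_proper_convex g \<and>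
     (\<forall>x. \<phi> differentiable (at x)) \<and> continuous_on UNIV (grad \<phi>) \<and>
     Luu > 0 \<and> Luv > 0 \<and> Lvu > 0 \<and> Lvv > 0 \<and>
     (\<forall>u u' v v'.
        norm (grad_u \<phi> u v - grad_u \<phi> u' v') \<le> Luu * norm (u - u') + Luv * norm (v - v') \<and>
        norm (grad_v \<phi> u v - grad_v \<phi> u' v') \<le> Lvu * norm (u - u') + Lvv * norm (v - v'))"

definition saddle_subdifferential ::
  "('u::real_inner \<Rightarrow> ereal) \<Rightarrow> ('v::real_inner \<Rightarrow> ereal) \<Rightarrow> ('u \<times> 'v \<Rightarrow> real) \<Rightarrow>
   'u \<times> 'v \<Rightarrow> ('u \<times> 'v) set" where
  "saddle_subdifferential f g \<phi> = (\<lambda>(u, v).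
     {(grad_u \<phi> u v + p, - grad_v \<phi> u v + q) | p q.
        p \<in> subdifferential f u \<and> q \<in> subdifferential g v})"

definition sa_kernel :: "('a::real_normed_vector \<Rightarrow> real) \<Rightarrow> real \<Rightarrow> 'a \<Rightarrow> real" where
  "sa_kernel \<phi> t = (\<lambda>x. 1 / (2 * t) * (norm x)\<^sup>2 - \<phi> x)"

definition accepted ::
  "('a::real_inner \<Rightarrow> 'a set) \<Rightarrow> ('a \<Rightarrow> real) \<Rightarrow> real \<Rightarrow> 'a \<Rightarrow> 'a \<Rightarrow> bool" where
  "accepted M \<phi> t x y \<longleftrightarrow>
     y \<in> resolvent M (sa_kernel \<phi> t) x \<and>
     t / 4 * (norm (grad (sa_kernel \<phi> t) y - grad (sa_kernel \<phi> t) x))\<^sup>2 \<le> bregman (sa_kernel \<phi> t) y x"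

text \<open>
  The iterates \<open>x\<close> and step sizes \<open>\<tau>\<close> of a run of the method. The trial count is the least
  \<open>i\<close> for which some resolvent point is accepted with step size \<open>\<delta>\<^sup>i \<tau>\<^sub>k\<close>, and the next
  iterate is such an accepted point. The requirement that the next iterate is accepted at the
  least \<open>i\<close> also ensures that an accepting \<open>i\<close> exists, so \<open>LEAST\<close> is well-defined here.
\<close>

definition sa_mgda_linesearch ::
  "('a::real_inner \<Rightarrow> 'a set) \<Rightarrow> ('a \<Rightarrow> real) \<Rightarrow> real \<Rightarrow> real \<Rightarrow> 'a \<Rightarrow>
   (nat \<Rightarrow> 'a) \<Rightarrow> (nat \<Rightarrow> real) \<Rightarrow> bool" where
  "sa_mgda_linesearch M \<phi> \<tau>0 \<delta> x0 x \<tau> \<longleftrightarrow>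
     x 0 = x0 \<and> \<tau> 0 = \<tau>0 \<and>
     (\<forall>k. \<tau> (Suc k) = \<delta> ^ (LEAST i. \<exists>y. accepted M \<phi> (\<delta> ^ i * \<tau> k) (x k) y) * \<tau> k \<and>
          accepted M \<phi> (\<tau> (Suc k)) (x k) (x (Suc k)))"

end

theory Submission
  imports Defs
begin

text \<open>
  One iteration is a Bregman proximal point step on \<open>M\<close>: with \<open>h = h\<^sub>i\<close>, the vector
  \<open>w = \<nabla>h(x\<^bsub>i-1\<^esub>) - \<nabla>h(x\<^sub>i)\<close> lies in \<open>M x\<^sub>i\<close>. The three-point identity therefore expresses
  \<open>D\<^sub>h(x\<^sub>*, x\<^sub>i) - D\<^sub>h(x\<^sub>*, x\<^bsub>i-1\<^esub>) + D\<^sub>h(x\<^sub>i, x\<^bsub>i-1\<^esub>)\<close> as \<open>- \<langle>x\<^sub>i - x\<^sub>*, w\<rangle>\<close>, which the weak MVI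
  condition bounds by \<open>\<rho>/2 \<parallel>w\<parallel>\<^sup>2\<close>. The acceptance test bounds \<open>\<parallel>w\<parallel>\<^sup>2\<close> by \<open>4/\<tau>\<^sub>i\<close> times
  \<open>D\<^sub>h(x\<^sub>i, x\<^bsub>i-1\<^esub>)\<close>, so a fraction \<open>1 - 2\<rho>/\<tau>\<^sub>i\<close> of this distance survives as descent
  (\<open>bregman_descent\<close>).

  For the fraction to stay above \<open>1 - \<rho> Ltilde > 0\<close> the step sizes must not fall below
  \<open>2 / Ltilde = \<delta> / (L + Lhat)\<close>. This holds because every trial step \<open>t < 1 / (L + Lhat)\<close>
  is accepted (\<open>accepted_exists\<close>), for two reasons. The acceptance inequality is the cocoercivity
  of \<open>\<nabla>h\<close>, valid between any two points once \<open>t L \<le> 1\<close> (\<open>sa_kernel_cocoercive\<close>). The resolvent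
  point exists because the resolvent inclusion is triangular: the gradient \<open>\<nabla>\<^sub>u \<phi>\<close> at the new point
  cancels in the first block, leaving a proximal step, while in the second block it doubles, leaving
  a fixed-point problem for a proximal map composed with a map of Lipschitz constant at most
  \<open>t (L + Lvv) < 1\<close> (\<open>resolvent_nonempty\<close>).

  Finally the descent inequalities are added up. The kernel changes with the step size, and passing
  from \<open>h\<^sub>i\<close> to \<open>h\<^bsub>i+1\<^esub>\<close> costs \<open>(1/(2\<tau>\<^bsub>i+1\<^esub>) - 1/(2\<tau>\<^sub>i)) \<parallel>x\<^sub>* - x\<^sub>i\<parallel>\<^sup>2\<close>. As the step sizes decrease, the
  factors are nonnegative, and the bound \<open>C\<close> makes these costs telescope
  (\<open>bregman_telescoping\<close>). The last distance \<open>D\<^sub>h(x\<^sub>*, x\<^sub>k)\<close> may be negative, since \<open>h\<^sub>k\<close> need not be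
  convex when \<open>\<tau>\<^sub>k\<close> is large, but the descent lemma bounds it from below, and the accumulated cost
  together with this deficit is at most \<open>Ltilde/2 C\<^sup>2\<close>. Bounding the sum below by \<open>k\<close> times its
  smallest term gives the rate.
\<close>

section \<open>Gradients\<close>

lemma grad_eqI:
  assumes "GDERIV h x :> D"
  shows "grad h x = D"
proof -
  have "E = D" if "GDERIV h x :> E" for E
  proof -
    have "(\<lambda>y. y \<bullet> E) = (\<lambda>y. y \<bullet> D)"
      using has_derivative_unique that assms unfolding gderiv_def by blast
    then show ?thesis by (metis vector_eq_ldot)
  qed
  then show ?thesis
    unfolding grad_def using assms by blast
qed

lemma GDERIV_grad:
  fixes h :: "'a::euclidean_space \<Rightarrow> real"
  assumes "h differentiable (at x)"
  shows "GDERIV h x :> grad h x"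
proof -
  obtain h' where h': "(h has_derivative h') (at x)"
    using assms by (auto simp: differentiable_def)
  then have "linear h'"
    using has_derivative_linear by blast
  then have "h' = (\<lambda>y. y \<bullet> adjoint h' 1)"
    using adjoint_works[of h'] by auto
  with h' have "GDERIV h x :> adjoint h' 1"
    unfolding gderiv_def by simp
  with grad_eqI[OF this] show ?thesis by simp
qed

lemma grad_sa_kernel:
  fixes \<phi> :: "'a::euclidean_space \<Rightarrow> real"
  assumes "\<phi> differentiable (at x)"
  shows "grad (sa_kernel \<phi> t) x = (1 / t) *\<^sub>R x - grad \<phi> x"
proof (rule grad_eqI)
  show "GDERIV (sa_kernel \<phi> t) x :> (1 / t) *\<^sub>R x - grad \<phi> x"
    using GDERIV_grad[OF assms] unfolding gderiv_def sa_kernel_def power2_norm_eq_inner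
    by (cases "t = 0") (auto intro!: derivative_eq_intros simp: inner_diff_right inner_commute)
qed

lemma grad_u_eq_fst_grad:
  fixes \<phi> :: "'u::euclidean_space \<times> 'v::euclidean_space \<Rightarrow> real"
  assumes "\<phi> differentiable (at (u, v))"
  shows "grad_u \<phi> u v = fst (grad \<phi> (u, v))"
  unfolding grad_u_def
proof (rule grad_eqI)
  have 1: "((\<lambda>w. (w, v)) has_derivative (\<lambda>w. (w, 0))) (at u)"
    by (auto intro!: derivative_eq_intros)
  have "(\<phi> has_derivative (\<lambda>y. y \<bullet> grad \<phi> (u, v))) (at (u, v))"
    using GDERIV_grad[OF assms] by (simp add: gderiv_def)
  from has_derivative_compose[OF 1 this]
  show "GDERIV (\<lambda>w. \<phi> (w, v)) u :> fst (grad \<phi> (u, v))"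
    by (simp add: gderiv_def inner_prod_def)
qed

lemma grad_v_eq_snd_grad:
  fixes \<phi> :: "'u::euclidean_space \<times> 'v::euclidean_space \<Rightarrow> real"
  assumes "\<phi> differentiable (at (u, v))"
  shows "grad_v \<phi> u v = snd (grad \<phi> (u, v))"
  unfolding grad_v_def
proof (rule grad_eqI)
  have 1: "((\<lambda>w. (u, w)) has_derivative (\<lambda>w. (0, w))) (at v)"
    by (auto intro!: derivative_eq_intros)
  have "(\<phi> has_derivative (\<lambda>y. y \<bullet> grad \<phi> (u, v))) (at (u, v))"
    using GDERIV_grad[OF assms] by (simp add: gderiv_def)
  from has_derivative_compose[OF 1 this]
  show "GDERIV (\<lambda>w. \<phi> (u, w)) v :> snd (grad \<phi> (u, v))"
    by (simp add: gderiv_def inner_prod_def)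
qed

section \<open>Bregman distances\<close>

lemma bregman_three_point:
  "bregman h z x = bregman h z y + bregman h y x + (grad h y - grad h x) \<bullet> (z - y)"
  by (simp add: bregman_def inner_diff_left inner_diff_right)

text \<open>Bregman distances are linear in the kernel, and \<open>\<parallel>a - b\<parallel>\<^sup>2\<close> is the one generated by the
  squared norm.\<close>

lemma bregman_sa_kernel:
  fixes \<phi> :: "'a::euclidean_space \<Rightarrow> real"
  assumes "\<phi> differentiable (at b)"
  shows "bregman (sa_kernel \<phi> t) a b = 1 / (2 * t) * (norm (a - b))\<^sup>2 - bregman \<phi> a b"
proof -
  have "(norm (a - b))\<^sup>2 = (norm a)\<^sup>2 - (norm b)\<^sup>2 - 2 * (b \<bullet> (a - b))"
    by (simp add: power2_norm_eq_inner inner_diff_left inner_diff_right inner_commute)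
  then have "1 / (2 * t) * (norm (a - b))\<^sup>2
      = 1 / (2 * t) * (norm a)\<^sup>2 - 1 / (2 * t) * (norm b)\<^sup>2 - 1 / t * (b \<bullet> (a - b))"
    by (simp add: diff_divide_distrib)
  then show ?thesis
    by (simp only: bregman_def grad_sa_kernel[OF assms] inner_diff_left inner_scaleR_left)
      (simp add: sa_kernel_def)
qed

text \<open>Along the segment from \<open>b\<close> to \<open>a\<close>, the function \<open>\<phi>\<close> minus its linearisation at \<open>b\<close> minus
  the parabola \<open>L/2 s\<^sup>2 \<parallel>a - b\<parallel>\<^sup>2\<close> has nonpositive derivative by the Cauchy-Schwarz inequality.\<close>

lemma lipschitz_gradient_descent:
  fixes \<phi> :: "'a::real_inner \<Rightarrow> real"
  assumes G: "\<And>x. GDERIV \<phi> x :> G x" and L: "L-lipschitz_on UNIV G"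
  shows "\<phi> a - \<phi> b - G b \<bullet> (a - b) \<le> L / 2 * (norm (a - b))\<^sup>2"
proof -
  define q where "q s = \<phi> (b + s *\<^sub>R (a - b)) - s * (G b \<bullet> (a - b)) - L / 2 * s\<^sup>2 * (norm (a - b))\<^sup>2"
    for s
  define q' where "q' s = (G (b + s *\<^sub>R (a - b)) - G b) \<bullet> (a - b) - L * s * (norm (a - b))\<^sup>2" for s
  have "(q has_real_derivative q' s) (at s)" for s
  proof -
    have 1: "((\<lambda>s. b + s *\<^sub>R (a - b)) has_derivative (\<lambda>e. e *\<^sub>R (a - b))) (at s)"
      by (auto intro!: derivative_eq_intros)
    have 2: "(\<phi> has_derivative (\<lambda>y. y \<bullet> G (b + s *\<^sub>R (a - b)))) (at (b + s *\<^sub>R (a - b)))"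
      using G by (simp add: gderiv_def)
    have "((\<lambda>s. \<phi> (b + s *\<^sub>R (a - b))) has_real_derivative G (b + s *\<^sub>R (a - b)) \<bullet> (a - b)) (at s)"
      using has_derivative_compose[OF 1 2]
      by (simp add: has_field_derivative_def inner_commute mult.commute[of _ "(a - b) \<bullet> _"])
    then show ?thesis
      unfolding q_def q'_def by (auto intro!: derivative_eq_intros simp: inner_diff_left)
  qed
  moreover have "q' s \<le> 0" if "0 \<le> s" for s
  proof -
    have "(G (b + s *\<^sub>R (a - b)) - G b) \<bullet> (a - b) \<le> norm (G (b + s *\<^sub>R (a - b)) - G b) * norm (a - b)"
      by (rule norm_cauchy_schwarz)
    also have "\<dots> \<le> (L * norm (s *\<^sub>R (a - b))) * norm (a - b)"
      using lipschitz_onD[OF L, of "b + s *\<^sub>R (a - b)" b]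
      by (intro mult_right_mono) (auto simp: dist_norm)
    finally show ?thesis
      using that by (simp add: q'_def power2_eq_square mult_ac)
  qed
  ultimately have "q 1 \<le> q 0"
    using DERIV_nonpos_imp_nonincreasing[of 0 1 q] by force
  then show ?thesis by (simp add: q_def)
qed

text \<open>The gradient of \<open>- \<phi>\<close> has the same Lipschitz constant, so the descent lemma works in both
  directions.\<close>

lemma abs_bregman_le:
  fixes \<phi> :: "'a::euclidean_space \<Rightarrow> real"
  assumes d: "\<And>x. \<phi> differentiable (at x)" and L: "L-lipschitz_on UNIV (grad \<phi>)"
  shows "\<bar>bregman \<phi> a b\<bar> \<le> L / 2 * (norm (a - b))\<^sup>2"
proof -
  have *: "GDERIV (\<lambda>x. - \<phi> x) x :> - grad \<phi> x" for x
    by (rule GDERIV_minus[OF GDERIV_grad[OF d]])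
  have "L-lipschitz_on UNIV (\<lambda>x. - grad \<phi> x)"
    using L by (simp add: lipschitz_on_def dist_norm norm_minus_commute)
  from lipschitz_gradient_descent[OF * this, of a b]
  have "- bregman \<phi> a b \<le> L / 2 * (norm (a - b))\<^sup>2"
    by (simp add: bregman_def)
  moreover have "bregman \<phi> a b \<le> L / 2 * (norm (a - b))\<^sup>2"
    unfolding bregman_def by (rule lipschitz_gradient_descent[OF GDERIV_grad[OF d] L])
  ultimately show ?thesis by (rule abs_leI[rotated])
qed

text \<open>For \<open>t L \<le> 1\<close> the kernel \<open>h\<close> is convex, and its gradient is Lipschitz with constant
  \<open>1/t + L \<le> 2/t\<close>. For such functions the inequality is the classical cocoercivity estimate: the
  convex function \<open>D\<^sub>h(_, x)\<close> is nonnegative, in particular at the point reached from \<open>y\<close> by one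
  gradient step, and such a step lowers it by at least \<open>t/4\<close> times the squared norm of its gradient
  \<open>\<nabla>h(y) - \<nabla>h(x)\<close>.\<close>

lemma sa_kernel_cocoercive:
  fixes \<phi> :: "'a::euclidean_space \<Rightarrow> real"
  assumes d: "\<And>x. \<phi> differentiable (at x)" and L: "L-lipschitz_on UNIV (grad \<phi>)"
    and t: "0 < t" "t * L \<le> 1"
  shows "t / 4 * (norm (grad (sa_kernel \<phi> t) y - grad (sa_kernel \<phi> t) x))\<^sup>2
           \<le> bregman (sa_kernel \<phi> t) y x"
proof -
  define h where "h = sa_kernel \<phi> t"
  define w where "w = grad h y - grad h x"
  \<comment> \<open>\<open>t / 2\<close> is the reciprocal of the Lipschitz constant \<open>2 / t\<close> of \<open>\<nabla>h\<close>\<close>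
  define z where "z = y - (t / 2) *\<^sub>R w"
  have bounds: "0 \<le> bregman h a b \<and> bregman h a b \<le> 1 / t * (norm (a - b))\<^sup>2" for a b
  proof -
    have "L / 2 * (norm (a - b))\<^sup>2 \<le> 1 / (2 * t) * (norm (a - b))\<^sup>2"
      using t by (intro mult_right_mono) (auto simp: field_simps)
    then show ?thesis
      using abs_bregman_le[OF d L, of a b] bregman_sa_kernel[OF d, of t a b]
      unfolding h_def by (simp add: field_simps) linarith
  qed
  have "0 \<le> bregman h z y + bregman h y x + w \<bullet> (z - y)"
    using bounds[of z x] bregman_three_point[of h z x y] by (simp add: w_def)
  also have "\<dots> \<le> 1 / t * (norm (z - y))\<^sup>2 + bregman h y x + w \<bullet> (z - y)"
    using bounds[of z y] by simp
  also have "\<dots> = bregman h y x - t / 4 * (norm w)\<^sup>2"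
    using t by (simp add: z_def power_mult_distrib flip: power2_norm_eq_inner)
      (simp add: power2_eq_square)
  finally show ?thesis by (simp add: h_def w_def)
qed

section \<open>The proximal map\<close>

text \<open>If \<open>g v = \<infinity>\<close>, a subgradient inequality at \<open>v\<close> would force \<open>g\<close> to be infinite everywhere.\<close>

lemma subdifferential_finite:
  assumes "closed_proper_convex g" "p \<in> subdifferential g v"
  obtains r where "g v = ereal r"
proof -
  obtain y where "g y \<noteq> \<infinity>" "g v \<noteq> -\<infinity>"
    using assms(1) by (auto simp: closed_proper_convex_def)
  moreover have "g v + ereal (p \<bullet> (y - v)) \<le> g y"
    using assms(2) by (simp add: subdifferential_def)
  ultimately show ?thesis
    using that by (cases "g v") auto
qed

lemma subdifferential_monotone:
  assumes g: "closed_proper_convex g"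
    and p: "p \<in> subdifferential g v" and q: "q \<in> subdifferential g w"
  shows "0 \<le> (p - q) \<bullet> (v - w)"
proof -
  obtain r s where rs: "g v = ereal r" "g w = ereal s"
    using subdifferential_finite[OF g p] subdifferential_finite[OF g q] by metis
  have "g v + ereal (p \<bullet> (w - v)) \<le> g w" "g w + ereal (q \<bullet> (v - w)) \<le> g v"
    using p q by (auto simp: subdifferential_def)
  then have "r + p \<bullet> (w - v) \<le> s" "s + q \<bullet> (v - w) \<le> r"
    by (auto simp: rs)
  then show ?thesis
    by (simp add: inner_diff_left inner_diff_right)
qed

text \<open>A point strictly below the graph is separated from the closed convex epigraph by a hyperplane.
  It is not vertical because the graph point right above lies on the other side of it.\<close>

lemma affine_minorant:
  assumes g: "closed_proper_convex g"
  shows "\<exists>a c. \<forall>y r. (y, r) \<in> epi g \<longrightarrow> c + a \<bullet> y \<le> r"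
proof -
  obtain w s where w: "g w = ereal s"
    using g by (metis closed_proper_convex_def ereal_cases)
  have "(w, s - 1) \<notin> epi g" by (simp add: epi_def w)
  with g obtain n b where n: "n \<bullet> (w, s - 1) < b" "\<And>x. x \<in> epi g \<Longrightarrow> b < n \<bullet> x"
    unfolding closed_proper_convex_def by (metis separating_hyperplane_closed_point)
  obtain a \<beta> where ab: "n = (a, \<beta>)" by (cases n)
  have "b < n \<bullet> (w, s)" using n(2) by (simp add: epi_def w)
  with n(1) have \<beta>: "0 < \<beta>" by (simp add: ab inner_prod_def algebra_simps)
  show ?thesis
  proof (intro exI allI impI)
    fix y r assume "(y, r) \<in> epi g"
    from n(2)[OF this] show "b / \<beta> + ((- 1 / \<beta>) *\<^sub>R a) \<bullet> y \<le> r"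
      using \<beta> by (simp add: ab inner_prod_def field_simps)
  qed
qed

text \<open>The minimisation is carried out over pairs in the epigraph, where the objective is a continuous
  real function. It is coercive there, since the quadratic term dominates the affine minorant of
  \<open>g\<close>, so a sublevel set is compact.\<close>

lemma proximal_minimizer_exists:
  fixes g :: "'a::euclidean_space \<Rightarrow> ereal"
  assumes g: "closed_proper_convex g" and t: "0 < t"
  shows "\<exists>v r. (v, r) \<in> epi g \<and>
    (\<forall>y s. (y, s) \<in> epi g \<longrightarrow> r + (norm (v - z))\<^sup>2 / (2 * t) \<le> s + (norm (y - z))\<^sup>2 / (2 * t))"
proof -
  define F where "F = (\<lambda>(y, s). s + (norm (y - z))\<^sup>2 / (2 * t))"
  obtain a c where ac: "\<And>y r. (y, r) \<in> epi g \<Longrightarrow> c + a \<bullet> y \<le> r"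
    using affine_minorant[OF g] by blast
  obtain w s where "g w = ereal s"
    using g by (metis closed_proper_convex_def ereal_cases)
  then have ws: "(w, s) \<in> epi g" by (simp add: epi_def)
  define K where "K = F (w, s)"
  define R where "R = sqrt (4 * t * (K - c - a \<bullet> z + t * (norm a)\<^sup>2))"
  define S where "S = epi g \<inter> {p. F p \<le> K}"
  have contF: "continuous_on UNIV F"
    unfolding F_def case_prod_beta using t by (intro continuous_intros) auto
  have "S \<subseteq> cball z R \<times> {c + a \<bullet> z - norm a * R .. K}"
  proof (rule subrelI)
    fix y r assume "(y, r) \<in> S"
    then have yr: "c + a \<bullet> y \<le> r" and FK: "r + (norm (y - z))\<^sup>2 / (2 * t) \<le> K"
      using ac by (auto simp: S_def F_def)
    \<comment> \<open>Young's inequality: half of the quadratic term absorbs the slope of the minorant\<close>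
    have "(norm (d + (2 * t) *\<^sub>R a))\<^sup>2 = (norm d)\<^sup>2 + 4 * t * (a \<bullet> d) + 4 * t\<^sup>2 * (norm a)\<^sup>2" for d
      unfolding power2_norm_eq_inner
      by (simp add: inner_add_left inner_add_right inner_commute power2_eq_square)
    from this[of "y - z"]
    have "0 \<le> (norm (y - z))\<^sup>2 + 4 * t * (a \<bullet> (y - z)) + 4 * t\<^sup>2 * (norm a)\<^sup>2"
      by (metis zero_le_power2)
    moreover have "4 * t * (c + a \<bullet> y) + 2 * (norm (y - z))\<^sup>2 \<le> 4 * t * K"
    proof -
      have "c + a \<bullet> y + (norm (y - z))\<^sup>2 / (2 * t) \<le> K" using yr FK by linarith
      then have "4 * t * (c + a \<bullet> y + (norm (y - z))\<^sup>2 / (2 * t)) \<le> 4 * t * K"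
        using t by (intro mult_left_mono) auto
      then show ?thesis using t by (simp add: distrib_left)
    qed
    ultimately have "(norm (y - z))\<^sup>2 \<le> 4 * t * (K - c - a \<bullet> z + t * (norm a)\<^sup>2)"
      by (simp add: inner_diff_right algebra_simps power2_eq_square)
    then have R: "norm (y - z) \<le> R"
      unfolding R_def by (rule real_le_rsqrt)
    have "- (a \<bullet> (y - z)) \<le> norm a * norm (y - z)"
      using Cauchy_Schwarz_ineq2[of a "y - z"] by linarith
    also have "\<dots> \<le> norm a * R" using R by (intro mult_left_mono) auto
    finally have "c + a \<bullet> z - norm a * R \<le> r" using yr by (simp add: inner_diff_right)
    moreover have "r \<le> K" using FK t by (smt (verit) zero_le_power2 divide_nonneg_pos)
    ultimately show "(y, r) \<in> cball z R \<times> {c + a \<bullet> z - norm a * R .. K}"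
      using R by (simp add: dist_norm norm_minus_commute)
  qed
  then have "bounded S"
    by (rule bounded_subset[rotated]) (auto intro!: bounded_Times)
  moreover have "closed S"
    unfolding S_def using g contF
    by (intro closed_Int closed_Collect_le) (auto simp: closed_proper_convex_def)
  moreover have "(w, s) \<in> S" using ws by (simp add: S_def K_def)
  moreover have "continuous_on S F" using contF continuous_on_subset by blast
  ultimately obtain p where p: "p \<in> S" "\<And>x. x \<in> S \<Longrightarrow> F p \<le> F x"
    using continuous_attains_inf[of S F] compact_eq_bounded_closed by blast
  have "F p \<le> F x" if "x \<in> epi g" for x
  proof (cases "F x \<le> K")
    case True
    then show ?thesis using p(2) that by (simp add: S_def)
  next
    case False
    then show ?thesis using p(1) by (simp add: S_def)
  qed
  with p(1) show ?thesis
    by (intro exI[of _ "fst p"] exI[of _ "snd p"]) (auto simp: F_def S_def case_prod_beta)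
qed

text \<open>The optimality condition of the proximal problem: comparing the minimiser \<open>v\<close> with the point
  \<open>v + e (y - v)\<close>, dividing by \<open>e\<close> and letting \<open>e\<close> tend to \<open>0\<close> gives the subgradient inequality
  at \<open>y\<close>. The point \<open>v\<close> is the value at \<open>z\<close> of the proximal map of \<open>g\<close> with step \<open>t\<close>.\<close>

lemma subdifferential_range:
  fixes g :: "'a::euclidean_space \<Rightarrow> ereal"
  assumes g: "closed_proper_convex g" and t: "0 < t"
  shows "\<exists>v. (1 / t) *\<^sub>R (z - v) \<in> subdifferential g v"
proof -
  obtain v r where vr: "(v, r) \<in> epi g" and
    min: "\<And>y s. (y, s) \<in> epi g \<Longrightarrow> r + (norm (v - z))\<^sup>2 / (2 * t) \<le> s + (norm (y - z))\<^sup>2 / (2 * t)"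
    using proximal_minimizer_exists[OF g t, of z] by blast
  have gv: "g v = ereal r"
  proof -
    have "g v \<noteq> -\<infinity>" "g v \<le> ereal r"
      using g vr by (auto simp: closed_proper_convex_def epi_def)
    then obtain r' where r': "g v = ereal r'" by (cases "g v") auto
    with min[of v r'] \<open>g v \<le> ereal r\<close> show ?thesis by (simp add: epi_def)
  qed
  have "g v + ereal (((1 / t) *\<^sub>R (z - v)) \<bullet> (y - v)) \<le> g y" for y
  proof (cases "g y")
    case (real s)
    define A where "A = s - r - (1 / t) * ((z - v) \<bullet> (y - v))"
    define B where "B = (norm (y - v))\<^sup>2 / (2 * t)"
    have AB: "0 \<le> A + e * B" if e: "0 < e" "e < 1" for e
    proof -
      have "(1 - e) *\<^sub>R (v, r) + e *\<^sub>R (y, s) \<in> epi g"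
        using g vr real e by (intro convexD) (auto simp: closed_proper_convex_def epi_def)
      then have "r + (norm (v - z))\<^sup>2 / (2 * t)
          \<le> (1 - e) * r + e * s + (norm (((1 - e) *\<^sub>R v + e *\<^sub>R y) - z))\<^sup>2 / (2 * t)"
        using min by simp
      also have "((1 - e) *\<^sub>R v + e *\<^sub>R y) - z = (v - z) + e *\<^sub>R (y - v)"
        by (simp add: algebra_simps)
      also have "(norm \<dots>)\<^sup>2 = (norm (v - z))\<^sup>2 - 2 * e * ((z - v) \<bullet> (y - v)) + e\<^sup>2 * (norm (y - v))\<^sup>2"
        unfolding power2_norm_eq_inner
        by (simp add: inner_add_left inner_add_right inner_diff_left inner_diff_right inner_commute
            power2_eq_square algebra_simps)
      finally have "0 \<le> e * (s - r) - e * (1 / t) * ((z - v) \<bullet> (y - v)) + e\<^sup>2 * B"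
        using t by (simp add: B_def add_divide_distrib diff_divide_distrib algebra_simps)
      then have "0 \<le> e * (A + e * B)"
        by (simp add: A_def algebra_simps power2_eq_square)
      then show ?thesis using e by (simp add: zero_le_mult_iff)
    qed
    have "((\<lambda>e. A + e * B) \<longlongrightarrow> A + 0 * B) (at_right 0)"
      by (intro tendsto_intros)
    moreover have "\<forall>\<^sub>F e in at_right 0. 0 \<le> A + e * B"
      using AB by (auto simp: eventually_at_right_field intro!: exI[of _ 1])
    ultimately have "0 \<le> A"
      using tendsto_lowerbound trivial_limit_at_right_real by fastforce
    then show ?thesis by (simp add: gv real A_def inner_commute)
  next
    case MInf
    then show ?thesis using g by (simp add: closed_proper_convex_def)
  qed simp
  then show ?thesis by (auto simp: subdifferential_def)
qed

text \<open>The inclusion says that \<open>v\<close> is the image of \<open>t T(v)\<close> under the proximal map \<open>P\<close>. Since \<open>P\<close> is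
  nonexpansive, by monotonicity of the subdifferential, \<open>v \<mapsto> P (t T(v))\<close> is a contraction.\<close>

lemma subdifferential_smooth_fixpoint:
  fixes g :: "'a::euclidean_space \<Rightarrow> ereal"
  assumes g: "closed_proper_convex g" and t: "0 < t"
    and T: "c-lipschitz_on UNIV T" and c: "t * c < 1"
  shows "\<exists>v. T v - (1 / t) *\<^sub>R v \<in> subdifferential g v"
proof -
  obtain P where P: "\<And>z. (1 / t) *\<^sub>R (z - P z) \<in> subdifferential g (P z)"
    using subdifferential_range[OF g t] by metis
  have nonexp: "norm (P a - P b) \<le> norm (a - b)" for a b
  proof -
    have "0 \<le> ((1 / t) *\<^sub>R (a - P a) - (1 / t) *\<^sub>R (b - P b)) \<bullet> (P a - P b)"
      by (rule subdifferential_monotone[OF g P P])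
    also have "\<dots> = (1 / t) * ((a - b) \<bullet> (P a - P b) - (norm (P a - P b))\<^sup>2)"
      unfolding power2_norm_eq_inner
      by (simp add: inner_diff_left inner_diff_right algebra_simps add_divide_distrib diff_divide_distrib)
    finally have "(norm (P a - P b))\<^sup>2 \<le> (a - b) \<bullet> (P a - P b)"
      using t by (simp add: zero_le_divide_iff)
    also have "\<dots> \<le> norm (a - b) * norm (P a - P b)" by (rule norm_cauchy_schwarz)
    finally show ?thesis
      by (cases "P a = P b") (auto simp: power2_eq_square)
  qed
  have c0: "0 \<le> c" using T lipschitz_on_nonneg by blast
  have "\<exists>!v\<in>UNIV. P (t *\<^sub>R T v) = v"
  proof (rule Banach_fix[of UNIV "t * c"])
    show "dist (P (t *\<^sub>R T v)) (P (t *\<^sub>R T w)) \<le> t * c * dist v w" for v w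
    proof -
      have "dist (P (t *\<^sub>R T v)) (P (t *\<^sub>R T w)) \<le> norm (t *\<^sub>R T v - t *\<^sub>R T w)"
        using nonexp by (simp add: dist_norm)
      also have "\<dots> = t * dist (T v) (T w)"
        using t by (simp add: dist_norm flip: scaleR_diff_right)
      also have "\<dots> \<le> t * (c * dist v w)"
        using lipschitz_onD[OF T] t by (intro mult_left_mono) auto
      finally show ?thesis by (simp add: mult.assoc)
    qed
  qed (use t c c0 in \<open>auto simp: complete_UNIV\<close>)
  then obtain v where "P (t *\<^sub>R T v) = v" by blast
  with P[of "t *\<^sub>R T v"] have "(1 / t) *\<^sub>R (t *\<^sub>R T v - v) \<in> subdifferential g v" by simp
  then show ?thesis using t by (auto simp: scaleR_diff_right)
qed

section \<open>The line search\<close>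

text \<open>In the inclusion \<open>\<nabla>h(x) - \<nabla>h(u, v) \<in> M (u, v)\<close> the left-hand side contains
  \<open>+ \<nabla>\<phi>(u, v)\<close>. In the \<open>u\<close> block it cancels against the term in \<open>M\<close>, so \<open>u\<close> is a proximal point and
  does not depend on \<open>v\<close>. In the \<open>v\<close> block, where \<open>M\<close> carries the opposite sign, the gradient
  doubles, and with \<open>u\<close> known the equation for \<open>v\<close> is a contractive fixed-point problem. The
  partial gradient \<open>\<nabla>\<^sub>v \<phi>(u, _)\<close> is Lipschitz with constant \<open>L\<close> and also with constant \<open>Lvv\<close>;
  counting one copy with each gives \<open>L + Lvv\<close> for its double.\<close>

lemma resolvent_nonempty:
  fixes f :: "'u::euclidean_space \<Rightarrow> ereal" and g :: "'v::euclidean_space \<Rightarrow> ereal"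
  assumes cs: "composite_smooth f g \<phi> Luu Luv Lvu Lvv"
    and L: "L-lipschitz_on UNIV (grad \<phi>)"
    and t: "0 < t" "t * (L + Lvv) < 1"
  shows "\<exists>y. y \<in> resolvent (saddle_subdifferential f g \<phi>) (sa_kernel \<phi> t) x"
proof -
  have f: "closed_proper_convex f" and g: "closed_proper_convex g"
    and d: "\<And>x. \<phi> differentiable (at x)" and Lvv: "0 < Lvv"
    and lipv: "\<And>u u' v v'. norm (grad_v \<phi> u v - grad_v \<phi> u' v') \<le> Lvu * norm (u - u') + Lvv * norm (v - v')"
    using cs by (auto simp: composite_smooth_def)
  have gu: "grad_u \<phi> u v = fst (grad \<phi> (u, v))" and gv: "grad_v \<phi> u v = snd (grad \<phi> (u, v))" for u v
    using grad_u_eq_fst_grad[OF d] grad_v_eq_snd_grad[OF d] by auto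
  define G where "G = grad (sa_kernel \<phi> t) x"
  obtain u where u: "(1 / t) *\<^sub>R (t *\<^sub>R fst G - u) \<in> subdifferential f u"
    using subdifferential_range[OF f t(1)] by blast
  have "(L + Lvv)-lipschitz_on UNIV (\<lambda>v. snd G + 2 *\<^sub>R grad_v \<phi> u v)"
  proof (rule lipschitz_onI)
    fix v v'
    have "norm (grad_v \<phi> u v - grad_v \<phi> u v') \<le> norm (grad \<phi> (u, v) - grad \<phi> (u, v'))"
      unfolding gv snd_diff[symmetric] by (metis norm_snd_le prod.collapse)
    also have "\<dots> \<le> L * norm (v - v')"
      using lipschitz_onD[OF L, of "(u, v)" "(u, v')"] by (simp add: dist_norm norm_Pair)
    finally have "2 * norm (grad_v \<phi> u v - grad_v \<phi> u v') \<le> (L + Lvv) * norm (v - v')"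
      using lipv[of u v u v'] by (simp add: distrib_right)
    moreover have "dist (snd G + 2 *\<^sub>R grad_v \<phi> u v) (snd G + 2 *\<^sub>R grad_v \<phi> u v')
        = 2 * norm (grad_v \<phi> u v - grad_v \<phi> u v')"
      by (simp add: dist_norm flip: scaleR_diff_right)
    ultimately show "dist (snd G + 2 *\<^sub>R grad_v \<phi> u v) (snd G + 2 *\<^sub>R grad_v \<phi> u v') \<le> (L + Lvv) * dist v v'"
      by (simp add: dist_norm)
  qed (use Lvv lipschitz_on_nonneg[OF L] in simp)
  from subdifferential_smooth_fixpoint[OF g t(1) this t(2)]
  obtain v where v: "snd G + 2 *\<^sub>R grad_v \<phi> u v - (1 / t) *\<^sub>R v \<in> subdifferential g v" by blast
  have "G - grad (sa_kernel \<phi> t) (u, v) =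
      (grad_u \<phi> u v + (1 / t) *\<^sub>R (t *\<^sub>R fst G - u),
       - grad_v \<phi> u v + (snd G + 2 *\<^sub>R grad_v \<phi> u v - (1 / t) *\<^sub>R v))"
    using t by (simp add: grad_sa_kernel[OF d] gu gv prod_eq_iff scaleR_diff_right scaleR_2)
  with u v have "(u, v) \<in> resolvent (saddle_subdifferential f g \<phi>) (sa_kernel \<phi> t) x"
    unfolding resolvent_def saddle_subdifferential_def G_def by auto
  then show ?thesis ..
qed

lemma accepted_exists:
  fixes f :: "'u::euclidean_space \<Rightarrow> ereal" and g :: "'v::euclidean_space \<Rightarrow> ereal"
  assumes cs: "composite_smooth f g \<phi> Luu Luv Lvu Lvv"
    and L: "L-lipschitz_on UNIV (grad \<phi>)"
    and t: "0 < t" "t * (L + Lvv) < 1"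
  shows "\<exists>y. accepted (saddle_subdifferential f g \<phi>) \<phi> t x y"
proof -
  have d: "\<And>x. \<phi> differentiable (at x)" and "0 < Lvv"
    using cs by (auto simp: composite_smooth_def)
  have "t * L \<le> t * (L + Lvv)" using t \<open>0 < Lvv\<close> by simp
  then have "t * L \<le> 1" using t(2) by linarith
  then show ?thesis
    using resolvent_nonempty[OF assms, of x] sa_kernel_cocoercive[OF d L t(1)]
    unfolding accepted_def by blast
qed

text \<open>If the search reduces the step, then the last rejected trial was at least \<open>b\<close>, and the
  accepted one is \<open>\<delta>\<close> times that trial.\<close>

lemma linesearch_stepsize:
  assumes run: "sa_mgda_linesearch M \<phi> \<tau>0 \<delta> x0 x \<tau>"
    and acc: "\<And>t x. 0 < t \<Longrightarrow> t < b \<Longrightarrow> \<exists>y. accepted M \<phi> t x y"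
    and \<delta>: "0 < \<delta>" "\<delta> < 1" and b: "0 < b" and init: "\<delta> * b \<le> \<tau>0"
  shows "\<delta> * b \<le> \<tau> k" and "\<tau> (Suc k) \<le> \<tau> k"
proof -
  define n where "n k = (LEAST i. \<exists>y. accepted M \<phi> (\<delta> ^ i * \<tau> k) (x k) y)" for k
  have step: "\<tau> (Suc k) = \<delta> ^ n k * \<tau> k" and \<tau>0: "\<tau> 0 = \<tau>0" for k
    using run by (auto simp: sa_mgda_linesearch_def n_def)
  have low: "\<delta> * b \<le> \<tau> k" for k
  proof (induction k)
    case 0
    show ?case using init by (simp add: \<tau>0)
  next
    case (Suc k)
    show ?case
    proof (cases "n k")
      case 0
      then show ?thesis using Suc step by simp
    next
      case (Suc m)
      then have "\<not> (\<exists>y. accepted M \<phi> (\<delta> ^ m * \<tau> k) (x k) y)"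
        using not_less_Least[of m] unfolding n_def by (metis lessI)
      moreover have "0 < \<delta> ^ m * \<tau> k"
        using \<delta> b Suc.IH by (smt (verit) mult_pos_pos zero_less_power)
      ultimately have "b \<le> \<delta> ^ m * \<tau> k"
        using acc by (meson not_le)
      then show ?thesis
        using \<delta> by (simp add: step Suc mult.assoc)
    qed
  qed
  show "\<delta> * b \<le> \<tau> k" by (rule low)
  have "0 \<le> \<tau> k" using low[of k] \<delta> b by (smt (verit) mult_pos_pos)
  then show "\<tau> (Suc k) \<le> \<tau> k"
    using \<delta> by (simp add: step mult_left_le_one_le power_le_one)
qed

section \<open>Convergence\<close>

text \<open>The acceptance test converts the violation \<open>\<rho>/2 \<parallel>w\<parallel>\<^sup>2\<close> permitted by the weak MVI condition
  into at most \<open>2\<rho>/t\<close> times the Bregman distance of the step.\<close>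

lemma bregman_descent:
  assumes acc: "accepted M \<phi> t x y" and xs: "xs \<in> weak_mvi_solutions \<rho> M"
    and t: "0 < t" and \<rho>: "0 \<le> \<rho>" and lt: "2 / t \<le> l"
  defines "h \<equiv> sa_kernel \<phi> t"
  shows "bregman h xs y \<le> bregman h xs x - (1 - \<rho> * l) * bregman h y x"
proof -
  define w where "w = grad h x - grad h y"
  have "w \<in> M y" and crit: "t / 4 * (norm w)\<^sup>2 \<le> bregman h y x"
    using acc by (auto simp: accepted_def resolvent_def w_def h_def norm_minus_commute)
  then have "- (\<rho> / 2) * (norm w)\<^sup>2 \<le> (y - xs) \<bullet> w"
    using xs by (auto simp: weak_mvi_solutions_def gra_def)
  moreover have "bregman h xs x = bregman h xs y + bregman h y x + (y - xs) \<bullet> w"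
    using bregman_three_point[of h xs x y]
    by (simp add: w_def inner_diff_left inner_diff_right inner_commute)
  moreover have "\<rho> / 2 * (norm w)\<^sup>2 \<le> \<rho> * l * bregman h y x"
  proof -
    have pos: "0 \<le> bregman h y x"
      using crit t by (smt (verit) divide_pos_pos mult_nonneg_nonneg zero_le_power2)
    have "(norm w)\<^sup>2 / 2 \<le> 2 / t * bregman h y x"
      using crit t by (simp add: field_simps)
    also have "\<dots> \<le> l * bregman h y x"
      using lt pos by (rule mult_right_mono)
    finally show ?thesis
      using mult_left_mono[OF _ \<rho>] by (fastforce simp: mult.assoc)
  qed
  ultimately show ?thesis by (simp add: algebra_simps)
qed

text \<open>Consecutive kernels differ by a nonnegative multiple of the squared norm, so replacing \<open>\<tau>\<^sub>i\<close> by
  \<open>\<tau>\<^bsub>i+1\<^esub>\<close> in \<open>D(x\<^sub>*, x\<^sub>i)\<close> adds the same multiple of \<open>\<parallel>x\<^sub>* - x\<^sub>i\<parallel>\<^sup>2 \<le> C\<^sup>2\<close>, and these multiples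
  telescope.\<close>

lemma bregman_telescoping:
  fixes x :: "nat \<Rightarrow> 'a::euclidean_space"
  assumes d: "\<And>x. \<phi> differentiable (at x)"
    and desc: "\<And>i. bregman (sa_kernel \<phi> (\<tau> (Suc i))) xs (x (Suc i)) + D i
                 \<le> bregman (sa_kernel \<phi> (\<tau> (Suc i))) xs (x i)"
    and pos: "\<And>i. 0 < \<tau> i" and dec: "\<And>i. \<tau> (Suc i) \<le> \<tau> i"
    and C: "\<And>i. norm (x i - xs) \<le> C"
  shows "(\<Sum>i<Suc n. D i) + bregman (sa_kernel \<phi> (\<tau> (Suc n))) xs (x (Suc n))
           \<le> bregman (sa_kernel \<phi> (\<tau> 1)) xs (x 0) + (1 / (2 * \<tau> (Suc n)) - 1 / (2 * \<tau> 1)) * C\<^sup>2"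
proof (induction n)
  case 0
  then show ?case using desc[of 0] by simp
next
  case (Suc n)
  let ?c = "1 / (2 * \<tau> (Suc (Suc n))) - 1 / (2 * \<tau> (Suc n))"
  have "bregman (sa_kernel \<phi> (\<tau> (Suc (Suc n)))) xs (x (Suc n))
      = bregman (sa_kernel \<phi> (\<tau> (Suc n))) xs (x (Suc n)) + ?c * (norm (xs - x (Suc n)))\<^sup>2"
    by (simp add: bregman_sa_kernel[OF d] algebra_simps)
  also have "?c * (norm (xs - x (Suc n)))\<^sup>2 \<le> ?c * C\<^sup>2"
    using C[of "Suc n"] dec[of "Suc n"] pos
    by (intro mult_left_mono power_mono) (auto simp: norm_minus_commute frac_le)
  finally have "bregman (sa_kernel \<phi> (\<tau> (Suc (Suc n)))) xs (x (Suc n))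
      \<le> bregman (sa_kernel \<phi> (\<tau> (Suc n))) xs (x (Suc n)) + ?c * C\<^sup>2" by simp
  with Suc desc[of "Suc n"] show ?case
    by (simp add: left_diff_distrib)
qed

lemma Min_le_average:
  fixes D :: "nat \<Rightarrow> real"
  assumes "1 \<le> k"
  shows "real k * (MIN i\<in>{1..k}. D i) \<le> (\<Sum>i=1..k. D i)"
  using sum_bounded_below[of "{1..k}" "MIN i\<in>{1..k}. D i" D] by simp

theorem theorem6p1:
  fixes f :: "'u::euclidean_space \<Rightarrow> ereal"
    and g :: "'v::euclidean_space \<Rightarrow> ereal"
    and \<phi> :: "'u \<times> 'v \<Rightarrow> real"
    and M :: "'u \<times> 'v \<Rightarrow> ('u \<times> 'v) set"
    and x :: "nat \<Rightarrow> 'u \<times> 'v"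
    and x0 xs :: "'u \<times> 'v"
    and \<tau> :: "nat \<Rightarrow> real"
    and h :: "nat \<Rightarrow> 'u \<times> 'v \<Rightarrow> real"
    and L Luu Luv Lvu Lvv Lhat Ltilde \<rho> \<tau>0 \<delta> C :: real
    and k :: nat
  assumes "composite_smooth f g \<phi> Luu Luv Lvu Lvv"
    and "L > 0" and "L-lipschitz_on UNIV (grad \<phi>)"
    and "Lhat = max Luu Lvv"
    and "M = saddle_subdifferential f g \<phi>"
    and "0 \<le> \<rho>" and "\<rho> < 1 / (2 * (L + Lhat))"
    and "weak_mvi \<rho> M"
    and "\<tau>0 \<ge> \<delta> / (L + Lhat)"
    and "2 * \<rho> * (L + Lhat) < \<delta>" and "\<delta> < 1"
    and "sa_mgda_linesearch M \<phi> \<tau>0 \<delta> x0 x \<tau>"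
    and "\<And>i. h i = sa_kernel \<phi> (\<tau> i)"
    and "xs \<in> weak_mvi_solutions \<rho> M"
    and "C \<ge> 0" and "\<And>i. norm (x i - xs) \<le> C"
    and "Ltilde = 2 * (L + Lhat) / \<delta>"
    and "k \<ge> 1"
  shows "(MIN i\<in>{1..k}. bregman (h i) (x i) (x (i - 1)))
           \<le> (bregman (h 1) xs x0 + Ltilde / 2 * C\<^sup>2) / ((1 - \<rho> * Ltilde) * real k)"
proof -
  have d: "\<And>x. \<phi> differentiable (at x)" and Lvv: "0 < Lvv"
    using assms(1) by (auto simp: composite_smooth_def)
  define S where "S = L + Lhat"
  have S: "0 < S" "L + Lvv \<le> S" "L < S" using \<open>L > 0\<close> Lvv assms(4) by (auto simp: S_def)
  have \<delta>0: "0 < \<delta>"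
    using assms(6) assms(10) S(1) by (smt (verit) S_def mult_nonneg_nonneg)
  have acc: "\<exists>y. accepted M \<phi> t z y" if t: "0 < t" "t < 1 / S" for t z
  proof -
    have "t * (L + Lvv) \<le> t * S" using S t by (intro mult_left_mono) auto
    also have "\<dots> < 1" using S t by (simp add: field_simps)
    finally show ?thesis
      using accepted_exists[OF assms(1) assms(3) t(1)] assms(5) by blast
  qed
  have init: "\<delta> * (1 / S) \<le> \<tau>0" using assms(9) by (simp add: S_def)
  note stepsize = linesearch_stepsize[OF assms(12) acc \<delta>0 assms(11) _ init]
  have low: "\<delta> / S \<le> \<tau> i" and dec: "\<tau> (Suc i) \<le> \<tau> i" for i
    using stepsize S by auto
  have pos: "0 < \<tau> i" for i
    using low[of i] \<delta>0 S by (smt (verit) divide_pos_pos)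
  have Lt: "2 / \<tau> i \<le> Ltilde" for i
    using low[of i] pos[of i] \<delta>0 S by (simp add: assms(17) flip: S_def) (simp add: field_simps)
  have factor: "0 < 1 - \<rho> * Ltilde"
    using assms(10) \<delta>0 by (simp add: assms(17) field_simps)
  define D where "D i = bregman (h i) (x i) (x (i - 1))" for i
  have run: "x 0 = x0" "accepted M \<phi> (\<tau> (Suc i)) (x i) (x (Suc i))" for i
    using assms(12) unfolding sa_mgda_linesearch_def by blast+
  have desc: "bregman (sa_kernel \<phi> (\<tau> (Suc i))) xs (x (Suc i)) + (1 - \<rho> * Ltilde) * D (Suc i)
      \<le> bregman (sa_kernel \<phi> (\<tau> (Suc i))) xs (x i)" for i
    using bregman_descent[OF run(2) assms(14) pos assms(6) Lt, of i] by (simp add: D_def assms(13))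
  obtain n where n: "k = Suc n" using \<open>k \<ge> 1\<close> by (cases k) auto
  define B where "B = bregman (h 1) xs x0 + Ltilde / 2 * C\<^sup>2"
  have tele: "(1 - \<rho> * Ltilde) * (\<Sum>i=1..k. D i) + bregman (sa_kernel \<phi> (\<tau> k)) xs (x k)
      \<le> bregman (h 1) xs x0 + (1 / (2 * \<tau> k) - 1 / (2 * \<tau> 1)) * C\<^sup>2"
  proof -
    have "(\<Sum>i<Suc n. (1 - \<rho> * Ltilde) * D (Suc i)) = (1 - \<rho> * Ltilde) * (\<Sum>i=1..k. D i)"
      unfolding n sum_distrib_left[symmetric] One_nat_def
      by (subst sum.atLeast1_atMost_eq) simp
    with bregman_telescoping[where \<phi> = \<phi> and x = x and \<tau> = \<tau> and D = "\<lambda>i. (1 - \<rho> * Ltilde) * D (Suc i)",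
        OF d desc pos dec assms(16), of n] show ?thesis
      by (simp add: n assms(13) run(1))
  qed
  \<comment> \<open>The last distance is at least \<open>(1 / (2 \<tau>\<^sub>k) - L / 2) \<parallel>x\<^sub>* - x\<^sub>k\<parallel>\<^sup>2\<close>. As \<open>L \<le> Ltilde\<close> and
    \<open>1 / \<tau>\<^sub>k \<le> Ltilde\<close>, writing \<open>Ltilde\<close> for \<open>L\<close> makes the coefficient of the deficit nonnegative,
    and the \<open>1 / (2 \<tau>\<^sub>k)\<close> terms cancel once the norm is replaced by \<open>C\<close>.\<close>
  have last: "- bregman (sa_kernel \<phi> (\<tau> k)) xs (x k) + (1 / (2 * \<tau> k) - 1 / (2 * \<tau> 1)) * C\<^sup>2
      \<le> Ltilde / 2 * C\<^sup>2"
  proof -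
    define r where "r = (norm (xs - x k))\<^sup>2"
    have r: "0 \<le> r" "r \<le> C\<^sup>2"
      using assms(16)[of k] by (auto simp: r_def norm_minus_commute intro: power_mono)
    have LLt: "L \<le> Ltilde"
    proof -
      have "L * \<delta> \<le> L * 1" using assms(11) \<open>L > 0\<close> by (intro mult_left_mono) auto
      then have "L * \<delta> \<le> 2 * S" using S \<open>L > 0\<close> by linarith
      then show ?thesis using \<delta>0 by (simp add: assms(17) S_def field_simps)
    qed
    have "1 / \<tau> k \<le> Ltilde"
      using Lt[of k] pos[of k] by (smt (verit) divide_right_mono)
    have "- bregman (sa_kernel \<phi> (\<tau> k)) xs (x k) \<le> (L / 2 - 1 / (2 * \<tau> k)) * r"
      using abs_bregman_le[OF d assms(3), of xs "x k"]
      by (simp add: bregman_sa_kernel[OF d] r_def left_diff_distrib)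
    moreover have "(L / 2 - 1 / (2 * \<tau> k)) * r \<le> (Ltilde / 2 - 1 / (2 * \<tau> k)) * C\<^sup>2"
      using LLt \<open>1 / \<tau> k \<le> Ltilde\<close> r by (intro mult_mono) (auto simp: field_simps)
    moreover have "0 \<le> 1 / (2 * \<tau> 1) * C\<^sup>2" using pos[of 1] by simp
    ultimately show ?thesis by (simp add: left_diff_distrib)
  qed
  have "(1 - \<rho> * Ltilde) * (real k * (MIN i\<in>{1..k}. D i)) \<le> (1 - \<rho> * Ltilde) * (\<Sum>i=1..k. D i)"
    using factor Min_le_average[OF \<open>k \<ge> 1\<close>] by (intro mult_left_mono) auto
  also have "\<dots> \<le> B" using tele last by (simp add: B_def)
  finally have "(MIN i\<in>{1..k}. D i) \<le> B / ((1 - \<rho> * Ltilde) * real k)"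
    using factor \<open>k \<ge> 1\<close> by (simp add: pos_le_divide_eq mult_ac)
  then show ?thesis by (simp add: D_def B_def)
qed

end
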